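(* For every $n\ge1$, every nondegenerate equilateral centroid triangle contained in $S_n=\{i,j,k\}^n$ is a local $\gamma$-cycle; equivalently, $$E_n^S=L_n^S .$$ Consequently, $$|E_n^S|=(2^n-1)\,3^{n-1}.$$
   Context: $\Delta_n=\{i,j,k,e\}^n$ is the set of words $b=b_1b_2\cdots b_n$ of length $n$ in the four symbols $i,j,k,e$. Put $v(i)=(\cos 210^\circ,\sin 210^\circ)$, $v(j)=(\cos 90^\circ,\sin 90^\circ)$, $v(k)=(\cos 330^\circ,\sin 330^\circ)$, $v(e)=(0,0)$ in $\mathbb R^2$. Fix a real $d_1>0$ and put $d_r=d_1/2^{r-1}$. The centroid map $P:\Delta_n\to\mathbb R^2$ is $$P(b)=\sum_{r=1}^n \sigma_r(b)\,d_r\,v(b_r),\qquad \sigma_r(b)=(-1)^{\#\{s<r:\ b_s=e\}}.$$ $E_n$ is the set of unordered triples $\{b_1,b_2,b_3\}$ of distinct words in $\Delta_n$ such that $P(b_1),P(b_2),P(b_3)$ are the vertices of a nondegenerate equilateral triangle. For $b\in\Delta_n$ put $\mathrm{supp}(b)=\{r: b_r\ne e\}$. Let $\gamma$ be the permutation $i\mapsto j\mapsto k\mapsto i$, $e\mapsto e$. For nonempty $S\subseteq\mathrm{supp}(b)$, $\gamma_S(b)$ is obtained by applying $\gamma$ in the coordinates of $S$ and fixing the others, and $T(b,S)=\{b,\gamma_S(b),\gamma_S^2(b)\}$, which is always an element of $E_n$; these triples are called local ($\gamma$-)cycles. The local class is $L_n=\{T(b,S): b\in\Delta_n,\ \varnothing\ne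 S\subseteq\mathrm{supp}(b)\}\subseteq E_n$. $S_n=\{i,j,k\}^n\subseteq\Delta_n$, $E_n^S=\{T\in E_n: T\subseteq S_n\}$, and $L_n^S=E_n^S\cap L_n$. *)

theory Defs
  imports "HOL-Analysis.Analysis"
begin

text \<open>
  Words are lists, so coordinates are numbered from \<open>0\<close>: the coordinate \<open>r\<close> below is the
  \<open>(r+1)\<close>-st letter of the word.
\<close>

datatype letter = Li | Lj | Lk | Le

definition Delta :: "nat \<Rightarrow> letter list set" where
  "Delta n = {b. length b = n}"

definition Full_words :: "nat \<Rightarrow> letter list set" where
  "Full_words n = {b. length b = n \<and> set b \<subseteq> {Li, Lj, Lk}}"

definition unit_at_degrees :: "real \<Rightarrow> real \<times> real" where
  "unit_at_degrees t = (cos (t * pi / 180), sin (t * pi / 180))"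

fun dir :: "letter \<Rightarrow> real \<times> real" where
  "dir Li = unit_at_degrees 210"
| "dir Lj = unit_at_degrees 90"
| "dir Lk = unit_at_degrees 330"
| "dir Le = (0, 0)"

definition sgn_at :: "letter list \<Rightarrow> nat \<Rightarrow> real" where
  "sgn_at b r = (-1) ^ card {s. s < r \<and> b ! s = Le}"

text \<open>With coordinates starting at \<open>0\<close>, the scale \<open>d\<^sub>1 / 2\<^sup>r\<^sup>-\<^sup>1\<close> becomes \<open>d1 / 2 ^ r\<close>.\<close>

definition centroid :: "real \<Rightarrow> letter list \<Rightarrow> real \<times> real" where
  "centroid d1 b = (\<Sum>r<length b. (sgn_at b r * (d1 / 2 ^ r)) *\<^sub>R dir (b ! r))"

definition nondegenerate_equilateral ::
  "real \<times> real \<Rightarrow> real \<times> real \<Rightarrow> real \<times> real \<Rightarrow> bool" where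
  "nondegenerate_equilateral p q r \<longleftrightarrow>
     dist p q = dist q r \<and> dist q r = dist r p \<and> dist p q > 0"

definition equilateral_triples :: "real \<Rightarrow> nat \<Rightarrow> letter list set set" where
  "equilateral_triples d1 n =
     {{a, b, c} | a b c. a \<in> Delta n \<and> b \<in> Delta n \<and> c \<in> Delta n \<and>
        a \<noteq> b \<and> b \<noteq> c \<and> a \<noteq> c \<and>
        nondegenerate_equilateral (centroid d1 a) (centroid d1 b) (centroid d1 c)}"

definition supp :: "letter list \<Rightarrow> nat set" where
  "supp b = {r. r < length b \<and> b ! r \<noteq> Le}"

fun cyc :: "letter \<Rightarrow> letter" where
  "cyc Li = Lj"
| "cyc Lj = Lk"
| "cyc Lk = Li"
| "cyc Le = Le"

definition cyc_on :: "nat set \<Rightarrow> letter list \<Rightarrow> letter list" where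
  "cyc_on S b = map (\<lambda>r. if r \<in> S then cyc (b ! r) else b ! r) [0..<length b]"

definition local_cycle :: "letter list \<Rightarrow> nat set \<Rightarrow> letter list set" where
  "local_cycle b S = {b, cyc_on S b, cyc_on S (cyc_on S b)}"

definition local_class :: "nat \<Rightarrow> letter list set set" where
  "local_class n = {local_cycle b S | b S. b \<in> Delta n \<and> S \<noteq> {} \<and> S \<subseteq> supp b}"

definition full_equilateral_triples :: "real \<Rightarrow> nat \<Rightarrow> letter list set set" where
  "full_equilateral_triples d1 n = {T \<in> equilateral_triples d1 n. T \<subseteq> Full_words n}"

definition full_local_class :: "real \<Rightarrow> nat \<Rightarrow> letter list set set" where
  "full_local_class d1 n = full_equilateral_triples d1 n \<inter> local_class n"

end

theory Submission
  imports Defs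
begin

text \<open>
  On words without the letter \<open>e\<close> all signs are \<open>+1\<close>, so the centroid is a dyadic expansion
  \<open>\<Sum> d\<^sub>r v(b\<^sub>r)\<close> whose digits are the three vectors \<open>v(i), v(j), v(k)\<close>. Let \<open>\<omega>\<close> be the rotation
  by \<open>-120\<close> degrees. It permutes the digits the way \<open>\<gamma>\<close> permutes the letters, so it acts on
  centroids by applying \<open>\<gamma>\<close> to every letter. The vertices of an equilateral triangle satisfy
  \<open>p + \<omega> q + \<omega>\<^sup>2 r = 0\<close>, up to exchanging \<open>q\<close> and \<open>r\<close>; for centroids of words \<open>a, b, c\<close> this says
  that the expansion with digits \<open>v(a\<^sub>r) + v(\<gamma> b\<^sub>r) + v(\<gamma>\<^sup>2 c\<^sub>r)\<close> vanishes.

  The digits lie in the lattice spanned by \<open>v(i)\<close> and \<open>v(j)\<close>, a copy of the Eisenstein integers.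
  Modulo \<open>2\<close> that lattice is the field with four elements, and the three letters become its three
  nonzero elements. Three nonzero elements of it add up to zero only if they are distinct, and three
  distinct letters add up to zero already over the integers. So a digit divisible by \<open>2\<close> is zero;
  since the last digit of a vanishing expansion is divisible by \<open>2\<close>, every digit is zero by induction
  (\<open>dyadic_expansion_unique\<close>). Hence \<open>a\<^sub>r, \<gamma> b\<^sub>r, \<gamma>\<^sup>2 c\<^sub>r\<close> are distinct for every \<open>r\<close>, which leaves
  only \<open>a\<^sub>r = b\<^sub>r = c\<^sub>r\<close> or \<open>(b\<^sub>r, c\<^sub>r) = (\<gamma> a\<^sub>r, \<gamma>\<^sup>2 a\<^sub>r)\<close>: the triple is a local cycle.

  Conversely, all local cycles of full words are nondegenerate equilateral triangles. The set \<open>S\<close> is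
  recovered from the triple as the set of its nonconstant coordinates, and for each of the \<open>2\<^sup>n - 1\<close>
  choices of \<open>S\<close> the cycles partition the \<open>3\<^sup>n\<close> full words into classes of size three.
\<close>

section \<open>Vanishing dyadic expansions in the triangular lattice\<close>

text \<open>The coefficients of \<open>dir l\<close> in the lattice basis \<open>dir Li, dir Lj\<close>.\<close>

fun coeff_i :: "letter \<Rightarrow> int" where
  "coeff_i Li = 1" | "coeff_i Lj = 0" | "coeff_i Lk = -1" | "coeff_i Le = 0"

fun coeff_j :: "letter \<Rightarrow> int" where
  "coeff_j Li = 0" | "coeff_j Lj = 1" | "coeff_j Lk = -1" | "coeff_j Le = 0"

lemma dir_coordinates:
  "dir Li = (- sqrt 3 / 2, - 1 / 2)"
  "dir Lj = (0, 1)"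
  "dir Lk = (sqrt 3 / 2, - 1 / 2)"
proof -
  have i: "210 * pi / 180 = pi / 6 + pi" by simp
  have k: "330 * pi / 180 = 2 * pi - pi / 6" by simp
  have j: "90 * pi / 180 = pi / 2" by simp
  show "dir Li = (- sqrt 3 / 2, - 1 / 2)"
    unfolding dir.simps unit_at_degrees_def i cos_periodic_pi sin_periodic_pi by (simp add: cos_30 sin_30)
  show "dir Lj = (0, 1)"
    unfolding dir.simps unit_at_degrees_def j by simp
  show "dir Lk = (sqrt 3 / 2, - 1 / 2)"
    unfolding dir.simps unit_at_degrees_def k cos_diff sin_diff by (simp add: cos_30 sin_30)
qed

lemma dir_in_basis:
  "dir l = of_int (coeff_i l) *\<^sub>R dir Li + of_int (coeff_j l) *\<^sub>R dir Lj"
  by (cases l) (simp_all add: dir_coordinates zero_prod_def del: dir.simps(1-3))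

lemma basis_independent:
  assumes "x *\<^sub>R dir Li + y *\<^sub>R dir Lj = 0"
  shows "x = 0" "y = 0"
  using assms by (auto simp: dir_coordinates zero_prod_def simp del: dir.simps(1-3))

text \<open>After multiplication by \<open>2 ^ n\<close>, every term but the last is an even integer.\<close>

lemma last_dyadic_digit_even:
  fixes F :: "nat \<Rightarrow> int"
  assumes "(\<Sum>r<Suc n. of_int (F r) / 2 ^ r :: real) = 0"
  shows "even (F n)"
proof -
  have scaled: "2 ^ n * (of_int (F r) / 2 ^ r) = (of_int (F r * 2 ^ (n - r)) :: real)"
    if "r < Suc n" for r
  proof -
    have "(2::real) ^ n = 2 ^ r * 2 ^ (n - r)"
      using that by (simp flip: power_add)
    then show ?thesis by simp
  qed
  have "0 = (\<Sum>r<Suc n. 2 ^ n * (of_int (F r) / 2 ^ r) :: real)"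
    unfolding sum_distrib_left[symmetric] assms by simp
  also have "\<dots> = (\<Sum>r<Suc n. of_int (F r * 2 ^ (n - r)))"
    by (intro sum.cong) (use scaled in auto)
  also have "\<dots> = of_int (\<Sum>r<Suc n. F r * 2 ^ (n - r))"
    by simp
  finally have "(\<Sum>r<Suc n. F r * 2 ^ (n - r)) = 0"
    by linarith
  then have "F n = - (\<Sum>r<n. F r * 2 ^ (n - r))"
    by simp
  moreover have "even (\<Sum>r<n. F r * 2 ^ (n - r))"
    by (intro dvd_sum) simp
  ultimately show ?thesis by simp
qed

text \<open>
  The last digit of a vanishing expansion is even, hence zero by the hypothesis on the digits;
  dropping it leaves a shorter vanishing expansion.
\<close>

lemma dyadic_expansion_unique:
  fixes F G :: "nat \<Rightarrow> int"
  assumes "d \<noteq> 0"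
    and "(\<Sum>r<n. (d / 2 ^ r) *\<^sub>R (of_int (F r) *\<^sub>R dir Li + of_int (G r) *\<^sub>R dir Lj)) = 0"
    and digit: "\<And>r. r < n \<Longrightarrow> even (F r) \<Longrightarrow> even (G r) \<Longrightarrow> F r = 0 \<and> G r = 0"
  shows "\<forall>r<n. F r = 0 \<and> G r = 0"
  using assms(2,3)
proof (induction n)
  case 0
  then show ?case by simp
next
  case (Suc n)
  have "(\<Sum>r<Suc n. (d / 2 ^ r) *\<^sub>R (of_int (F r) *\<^sub>R dir Li + of_int (G r) *\<^sub>R dir Lj))
    = (d * (\<Sum>r<Suc n. of_int (F r) / 2 ^ r)) *\<^sub>R dir Li
      + (d * (\<Sum>r<Suc n. of_int (G r) / 2 ^ r)) *\<^sub>R dir Lj"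
    unfolding sum_distrib_left scaleR_left.sum sum.distrib[symmetric]
    by (intro sum.cong) (simp_all add: scaleR_add_right del: dir.simps)
  then have "(d * (\<Sum>r<Suc n. of_int (F r) / 2 ^ r)) *\<^sub>R dir Li
      + (d * (\<Sum>r<Suc n. of_int (G r) / 2 ^ r)) *\<^sub>R dir Lj = 0"
    using Suc.prems(1) by simp
  from basis_independent[OF this]
  have "(\<Sum>r<Suc n. of_int (F r) / 2 ^ r :: real) = 0"
       "(\<Sum>r<Suc n. of_int (G r) / 2 ^ r :: real) = 0"
    using \<open>d \<noteq> 0\<close> mult_eq_0_iff by blast+
  then have "even (F n)" "even (G n)"
    by (simp_all only: last_dyadic_digit_even)
  then have zero: "F n = 0" "G n = 0"
    using Suc.prems(2)[of n] by auto
  have "\<forall>r<n. F r = 0 \<and> G r = 0"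
    by (rule Suc.IH) (use Suc.prems zero in auto)
  then show ?case
    using zero less_Suc_eq by auto
qed

section \<open>Centroids of full words\<close>

lemma full_word_nth:
  assumes "b \<in> Full_words n" "r < n"
  shows "b ! r \<noteq> Le"
proof -
  have "b ! r \<in> set b"
    using assms by (simp add: Full_words_def)
  then have "b ! r \<in> {Li, Lj, Lk}"
    using assms unfolding Full_words_def by blast
  then show ?thesis by auto
qed

lemma full_wordI:
  assumes "length b = n" "\<And>r. r < n \<Longrightarrow> b ! r \<noteq> Le"
  shows "b \<in> Full_words n"
proof -
  have "x \<in> {Li, Lj, Lk}" if "x \<in> set b" for x
  proof -
    have "x \<noteq> Le"
      using that assms by (metis in_set_conv_nth)
    then show ?thesis by (cases x) auto
  qed
  then show ?thesis
    using assms(1) by (auto simp: Full_words_def)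
qed

lemma centroid_full_word:
  assumes "b \<in> Full_words n"
  shows "centroid d b = (\<Sum>r<n. (d / 2 ^ r) *\<^sub>R dir (b ! r))"
proof -
  have len: "length b = n"
    using assms by (simp add: Full_words_def)
  have "sgn_at b r = 1" if "r < n" for r
  proof -
    have "{s. s < r \<and> b ! s = Le} = {}"
      using full_word_nth[OF assms] that by auto
    then show ?thesis by (simp only: sgn_at_def card.empty power_0)
  qed
  then show ?thesis
    unfolding centroid_def len by (intro sum.cong) simp_all
qed

lemma cyc_eq_Le [simp]: "cyc l = Le \<longleftrightarrow> l = Le"
  by (cases l) auto

lemma cyc_cyc_cyc [simp]: "cyc (cyc (cyc l)) = l"
  by (cases l) auto

lemma cyc_neq: "l \<noteq> Le \<Longrightarrow> cyc l \<noteq> l"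
  by (cases l) auto

lemma cyc_cyc_neq: "l \<noteq> Le \<Longrightarrow> cyc (cyc l) \<noteq> l"
  by (cases l) auto

text \<open>
  The next two facts together say that a sum of three letters divisible by \<open>2\<close> is zero, which is the
  digit condition of \<open>dyadic_expansion_unique\<close>.
\<close>

lemma letters_distinct_if_sum_even:
  assumes "x \<noteq> Le" "y \<noteq> Le" "z \<noteq> Le"
    and "even (coeff_i x + coeff_i y + coeff_i z)" "even (coeff_j x + coeff_j y + coeff_j z)"
  shows "x \<noteq> y \<and> y \<noteq> z \<and> x \<noteq> z"
  using assms by (cases x; cases y; cases z) auto

lemma distinct_letters_sum_zero:
  assumes "x \<noteq> Le" "y \<noteq> Le" "z \<noteq> Le" "x \<noteq> y \<and> y \<noteq> z \<and> x \<noteq> z"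
  shows "coeff_i x + coeff_i y + coeff_i z = 0 \<and> coeff_j x + coeff_j y + coeff_j z = 0"
  using assms by (cases x; cases y; cases z) auto

lemma distinct_letters_if_centroid_sum_zero:
  assumes "d \<noteq> 0" and full: "u \<in> Full_words n" "v \<in> Full_words n" "w \<in> Full_words n"
    and zero: "centroid d u + centroid d v + centroid d w = 0" and "r < n"
  shows "u ! r \<noteq> v ! r \<and> v ! r \<noteq> w ! r \<and> u ! r \<noteq> w ! r"
proof -
  define F where "F s = coeff_i (u ! s) + coeff_i (v ! s) + coeff_i (w ! s)" for s
  define G where "G s = coeff_j (u ! s) + coeff_j (v ! s) + coeff_j (w ! s)" for s
  have letters: "u ! s \<noteq> Le" "v ! s \<noteq> Le" "w ! s \<noteq> Le" if "s < n" for s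
    using full that full_word_nth by blast+
  have "of_int (F s) *\<^sub>R dir Li + of_int (G s) *\<^sub>R dir Lj
      = dir (u ! s) + dir (v ! s) + dir (w ! s)" for s
    unfolding F_def G_def dir_in_basis[of "u ! s"] dir_in_basis[of "v ! s"] dir_in_basis[of "w ! s"]
    by (simp add: algebra_simps del: dir.simps)
  then have "(\<Sum>s<n. (d / 2 ^ s) *\<^sub>R (of_int (F s) *\<^sub>R dir Li + of_int (G s) *\<^sub>R dir Lj)) = 0"
    using zero by (simp add: centroid_full_word[OF full(1)] centroid_full_word[OF full(2)]
        centroid_full_word[OF full(3)] scaleR_add_right sum.distrib del: dir.simps)
  then have "\<forall>s<n. F s = 0 \<and> G s = 0"
  proof (rule dyadic_expansion_unique[OF \<open>d \<noteq> 0\<close>])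
    fix s assume s: "s < n" "even (F s)" "even (G s)"
    show "F s = 0 \<and> G s = 0"
      unfolding F_def G_def
      using s letters_distinct_if_sum_even[OF letters[OF s(1)]] unfolding F_def G_def
      by (intro distinct_letters_sum_zero letters[OF s(1)])
  qed
  then have "F r = 0" "G r = 0"
    using \<open>r < n\<close> by blast+
  then show ?thesis
    by (intro letters_distinct_if_sum_even letters[OF \<open>r < n\<close>]) (simp_all only: F_def G_def dvd_0_right)
qed

text \<open>
  Nondegeneracy of local cycles needs this: two letters that agree modulo \<open>2\<close> are equal, so the
  same expansion argument applies to the digitwise difference of two words.
\<close>

lemma centroid_inj_on_full_words:
  assumes "d \<noteq> 0" and full: "u \<in> Full_words n" "v \<in> Full_words n"
    and eq: "centroid d u = centroid d v"
  shows "u = v"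
proof -
  define F where "F s = coeff_i (u ! s) - coeff_i (v ! s)" for s
  define G where "G s = coeff_j (u ! s) - coeff_j (v ! s)" for s
  have letters: "u ! s \<noteq> Le" "v ! s \<noteq> Le" if "s < n" for s
    using full that full_word_nth by blast+
  have same: "x = y" if "x \<noteq> Le" "y \<noteq> Le" "even (coeff_i x - coeff_i y)" "even (coeff_j x - coeff_j y)"
    for x y
    using that by (cases x; cases y) auto
  have "of_int (F s) *\<^sub>R dir Li + of_int (G s) *\<^sub>R dir Lj = dir (u ! s) - dir (v ! s)" for s
    unfolding F_def G_def dir_in_basis[of "u ! s"] dir_in_basis[of "v ! s"]
    by (simp add: algebra_simps del: dir.simps)
  then have "(\<Sum>s<n. (d / 2 ^ s) *\<^sub>R (of_int (F s) *\<^sub>R dir Li + of_int (G s) *\<^sub>R dir Lj)) = 0"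
    using eq by (simp add: centroid_full_word[OF full(1)] centroid_full_word[OF full(2)]
        scaleR_diff_right sum_subtractf del: dir.simps)
  then have zero: "\<forall>s<n. F s = 0 \<and> G s = 0"
  proof (rule dyadic_expansion_unique[OF \<open>d \<noteq> 0\<close>])
    fix s assume "s < n" "even (F s)" "even (G s)"
    then have "u ! s = v ! s"
      using same letters unfolding F_def G_def by blast
    then show "F s = 0 \<and> G s = 0"
      by (simp add: F_def G_def)
  qed
  show ?thesis
  proof (rule nth_equalityI)
    show "length u = length v"
      using full by (simp add: Full_words_def)
    fix s assume "s < length u"
    then have "s < n"
      using full by (simp add: Full_words_def)
    then show "u ! s = v ! s"
      using same letters zero unfolding F_def G_def by (metis dvd_0_right)
  qed
qed

section \<open>Equilateral triangles and rotation\<close>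

text \<open>The rotation by \<open>-120\<close> degrees, in the sense in which \<open>cyc\<close> turns the directions.\<close>

definition rot :: "real \<times> real \<Rightarrow> real \<times> real" where
  "rot z = (- fst z / 2 + sqrt 3 / 2 * snd z, - sqrt 3 / 2 * fst z - snd z / 2)"

lemma linear_rot: "linear rot"
  by (rule linearI) (auto simp: rot_def field_simps)

lemma rot_dir: "rot (dir l) = dir (cyc l)"
  by (cases l) (simp_all add: dir_coordinates rot_def del: dir.simps(1-3))

lemma norm_rot [simp]: "norm (rot z) = norm z"
proof -
  have "(fst (rot z))\<^sup>2 + (snd (rot z))\<^sup>2 = (fst z)\<^sup>2 + (snd z)\<^sup>2"
    by (simp add: rot_def power2_eq_square algebra_simps)
  then show ?thesis
    by (simp add: norm_prod_def)
qed

text \<open>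
  With \<open>z = q - p\<close> and \<open>w = r - p\<close>, equality of the three sides fixes the inner product of \<open>z\<close> and
  \<open>w\<close> to be \<open>\<bar>z\<bar>\<^sup>2 / 2\<close> and, by Lagrange's identity, their cross product to be \<open>\<plusminus> \<surd>3 \<bar>z\<bar>\<^sup>2 / 2\<close>.
  These two numbers determine \<open>w\<close> from \<open>z\<close>, and the sign is the orientation of the triangle.
\<close>

lemma equilateral_imp_rotation_sum:
  assumes "nondegenerate_equilateral p q r"
  shows "p + rot q + rot (rot r) = 0 \<or> p + rot r + rot (rot q) = 0"
proof -
  obtain p1 p2 where p: "p = (p1, p2)" by (cases p)
  obtain q1 q2 where q: "q = (q1, q2)" by (cases q)
  obtain r1 r2 where r: "r = (r1, r2)" by (cases r)
  define x y u v where "x = q1 - p1" and "y = q2 - p2" and "u = r1 - p1" and "v = r2 - p2"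
  note vars = x_def y_def u_def v_def
  have dist_sq: "(dist a b)\<^sup>2 = (fst a - fst b)\<^sup>2 + (snd a - snd b)\<^sup>2" for a b :: "real \<times> real"
    by (simp add: dist_prod_def dist_real_def)
  define N where "N = x\<^sup>2 + y\<^sup>2"
  have sides: "(dist p q)\<^sup>2 = (dist q r)\<^sup>2" "(dist q r)\<^sup>2 = (dist r p)\<^sup>2" "(dist p q)\<^sup>2 > 0"
    using assms by (auto simp: nondegenerate_equilateral_def)
  have "N > 0"
    using sides(3) unfolding dist_sq N_def vars p q r by (simp add: power2_commute)
  have N': "u\<^sup>2 + v\<^sup>2 = N"
    using sides unfolding dist_sq N_def vars p q r by (simp add: power2_commute)
  have N'': "(x - u)\<^sup>2 + (y - v)\<^sup>2 = N"
    using sides unfolding dist_sq N_def vars p q r by (simp add: power2_commute)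
  have dot: "x * u + y * v = N / 2"
    using N' N'' N_def by (simp add: power2_eq_square algebra_simps)
  \<comment> \<open>the cross product of the two sides at \<open>p\<close>\<close>
  define c where "c = x * v - y * u"
  have "c\<^sup>2 + (x * u + y * v)\<^sup>2 = (x\<^sup>2 + y\<^sup>2) * (u\<^sup>2 + v\<^sup>2)"
    unfolding c_def by (simp add: power2_eq_square algebra_simps)
  then have "c\<^sup>2 = (sqrt 3 / 2 * N)\<^sup>2"
    unfolding dot N' N_def[symmetric] by (simp add: power2_eq_square field_simps)
  then have "c = sqrt 3 / 2 * N \<or> c = - (sqrt 3 / 2 * N)"
    by (simp add: power2_eq_iff)
  moreover have "N * u = (x * u + y * v) * x - c * y" "N * v = (x * u + y * v) * y + c * x"
    unfolding c_def N_def by (simp_all add: power2_eq_square algebra_simps)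
  ultimately have "N * u = N * (x / 2 - sqrt 3 / 2 * y) \<and> N * v = N * (y / 2 + sqrt 3 / 2 * x)
    \<or> N * u = N * (x / 2 + sqrt 3 / 2 * y) \<and> N * v = N * (y / 2 - sqrt 3 / 2 * x)"
    unfolding dot
  proof (elim disjE)
    assume c: "c = sqrt 3 / 2 * N"
      and "N * u = N / 2 * x - c * y" "N * v = N / 2 * y + c * x"
    then show ?thesis
      unfolding c by (intro disjI1) (simp add: algebra_simps)
  next
    assume c: "c = - (sqrt 3 / 2 * N)"
      and "N * u = N / 2 * x - c * y" "N * v = N / 2 * y + c * x"
    then show ?thesis
      unfolding c by (intro disjI2) (simp add: algebra_simps)
  qed
  then have uv: "(u = x / 2 - sqrt 3 / 2 * y \<and> v = y / 2 + sqrt 3 / 2 * x)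
    \<or> (u = x / 2 + sqrt 3 / 2 * y \<and> v = y / 2 - sqrt 3 / 2 * x)"
    unfolding mult_cancel_left using \<open>N > 0\<close> by simp
  have s3: "sqrt 3 * (sqrt 3 * t) = 3 * t" for t :: real
    by (simp flip: mult.assoc)
  have qr: "q1 = p1 + x" "q2 = p2 + y" "r1 = p1 + u" "r2 = p2 + v"
    by (simp_all add: vars)
  show ?thesis
    using uv
  proof
    assume "u = x / 2 - sqrt 3 / 2 * y \<and> v = y / 2 + sqrt 3 / 2 * x"
    then have uv': "u = x / 2 - sqrt 3 / 2 * y" "v = y / 2 + sqrt 3 / 2 * x"
      by blast+
    have "p + rot r + rot (rot q) = 0"
      unfolding p q r qr uv' by (simp add: rot_def zero_prod_def s3 field_simps)
    then show ?thesis by blast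
  next
    assume "u = x / 2 + sqrt 3 / 2 * y \<and> v = y / 2 - sqrt 3 / 2 * x"
    then have uv': "u = x / 2 + sqrt 3 / 2 * y" "v = y / 2 - sqrt 3 / 2 * x"
      by blast+
    have "p + rot q + rot (rot r) = 0"
      unfolding p q r qr uv' by (simp add: rot_def zero_prod_def s3 field_simps)
    then show ?thesis by blast
  qed
qed

section \<open>Equilateral triples of full words are the local cycles\<close>

lemma length_cyc_on [simp]: "length (cyc_on S b) = length b"
  by (simp add: cyc_on_def)

lemma nth_cyc_on:
  "r < length b \<Longrightarrow> cyc_on S b ! r = (if r \<in> S then cyc (b ! r) else b ! r)"
  by (simp add: cyc_on_def)

lemma cyc_on_full_word [simp]:
  assumes "b \<in> Full_words n"
  shows "cyc_on S b \<in> Full_words n"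
proof -
  have "length b = n"
    using assms by (simp add: Full_words_def)
  then show ?thesis
    using full_word_nth[OF assms] by (intro full_wordI) (simp_all add: nth_cyc_on)
qed

lemma cyc_on_cube [simp]: "cyc_on S (cyc_on S (cyc_on S b)) = b"
  by (rule nth_equalityI) (auto simp: nth_cyc_on)

lemma supp_full_word:
  assumes "b \<in> Full_words n"
  shows "supp b = {..<n}"
proof -
  have "length b = n"
    using assms by (simp add: Full_words_def)
  then show ?thesis
    using full_word_nth[OF assms] by (auto simp: supp_def)
qed

lemma centroid_cyc_everywhere:
  assumes "b \<in> Full_words n"
  shows "centroid d (cyc_on UNIV b) = rot (centroid d b)"
proof -
  have "length b = n"
    using assms by (simp add: Full_words_def)
  then show ?thesis
    unfolding centroid_full_word[OF assms] centroid_full_word[OF cyc_on_full_word[OF assms]]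
      linear_sum[OF linear_rot]
    by (intro sum.cong) (simp_all add: linear_cmul[OF linear_rot] rot_dir nth_cyc_on del: dir.simps)
qed

text \<open>
  The coordinates outside \<open>S\<close> contribute equally to all three centroids, so one application of
  \<open>cyc_on S\<close> turns each side of the triangle into the next one.
\<close>

lemma centroid_cyc_on_diff:
  assumes "b \<in> Full_words n"
  shows "centroid d (cyc_on S b) - centroid d (cyc_on S (cyc_on S b))
    = rot (centroid d b - centroid d (cyc_on S b))"
proof -
  have "length b = n"
    using assms by (simp add: Full_words_def)
  moreover have "rot 0 = 0"
    by (simp add: linear_0[OF linear_rot])
  ultimately show ?thesis
    unfolding centroid_full_word[OF assms] centroid_full_word[OF cyc_on_full_word[OF assms]]
      centroid_full_word[OF cyc_on_full_word[OF cyc_on_full_word[OF assms]]]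
      linear_sum[OF linear_rot] sum_subtractf[symmetric] scaleR_diff_right[symmetric]
    by (intro sum.cong)
      (simp_all add: linear_cmul[OF linear_rot] linear_diff[OF linear_rot] rot_dir nth_cyc_on
        del: dir.simps)
qed

lemma cyc_on_distinct:
  assumes "b \<in> Full_words n" "S \<noteq> {}" "S \<subseteq> {..<n}"
  shows "b \<noteq> cyc_on S b" "cyc_on S b \<noteq> cyc_on S (cyc_on S b)" "b \<noteq> cyc_on S (cyc_on S b)"
proof -
  obtain r where r: "r \<in> S" "r < n"
    using assms by auto
  have len: "length b = n"
    using assms by (simp add: Full_words_def)
  have letter: "b ! r \<noteq> Le"
    using full_word_nth[OF assms(1)] r by simp
  have nths: "cyc_on S b ! r = cyc (b ! r)" "cyc_on S (cyc_on S b) ! r = cyc (cyc (b ! r))"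
    using r len by (simp_all add: nth_cyc_on)
  show "b \<noteq> cyc_on S b" "cyc_on S b \<noteq> cyc_on S (cyc_on S b)" "b \<noteq> cyc_on S (cyc_on S b)"
    using letter nths cyc_neq cyc_cyc_neq by (metis cyc_eq_Le)+
qed

lemma local_cycle_equilateral:
  assumes "d \<noteq> 0" "b \<in> Full_words n" "S \<noteq> {}" "S \<subseteq> {..<n}"
  shows "nondegenerate_equilateral (centroid d b) (centroid d (cyc_on S b))
    (centroid d (cyc_on S (cyc_on S b)))"
proof -
  let ?p = "centroid d b" and ?q = "centroid d (cyc_on S b)"
    and ?r = "centroid d (cyc_on S (cyc_on S b))"
  have "?q - ?r = rot (?p - ?q)" "?r - ?p = rot (?q - ?r)"
    using centroid_cyc_on_diff[OF assms(2), of d S]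
      centroid_cyc_on_diff[OF cyc_on_full_word[OF assms(2)], of d S S] by simp_all
  then have "dist ?p ?q = dist ?q ?r" "dist ?q ?r = dist ?r ?p"
    by (simp_all add: dist_norm)
  moreover have "?p \<noteq> ?q"
    using centroid_inj_on_full_words[OF assms(1,2) cyc_on_full_word[OF assms(2)]]
      cyc_on_distinct(1)[OF assms(2-4)] by blast
  ultimately show ?thesis
    by (metis nondegenerate_equilateral_def zero_less_dist_iff)
qed

text \<open>
  The letters \<open>x\<close>, \<open>cyc y\<close> and \<open>cyc (cyc z)\<close> are distinct only in two ways: they occur in the cyclic
  order starting at \<open>x\<close>, and then the letters agree, or in the opposite order, and then \<open>x, y, z\<close>
  is itself a cycle.
\<close>

lemma distinct_twisted_letters:
  assumes "x \<noteq> Le" "y \<noteq> Le" "z \<noteq> Le"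
    and "x \<noteq> cyc y \<and> cyc y \<noteq> cyc (cyc z) \<and> x \<noteq> cyc (cyc z)"
  shows "(y = x \<and> z = x) \<or> (y = cyc x \<and> z = cyc (cyc x))"
  using assms by (cases x; cases y; cases z) auto

lemma rotation_sum_imp_local_cycle:
  assumes "d \<noteq> 0" and full: "a \<in> Full_words n" "b \<in> Full_words n" "c \<in> Full_words n"
    and "a \<noteq> b"
    and zero: "centroid d a + rot (centroid d b) + rot (rot (centroid d c)) = 0"
  shows "\<exists>S. S \<noteq> {} \<and> S \<subseteq> {..<n} \<and> {a, b, c} = local_cycle a S"
proof -
  have len: "length a = n" "length b = n" "length c = n"
    using full by (simp_all add: Full_words_def)
  \<comment> \<open>rotations become letterwise shifts, so the relation is a vanishing sum of three centroids\<close>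
  have "centroid d a + centroid d (cyc_on UNIV b) + centroid d (cyc_on UNIV (cyc_on UNIV c)) = 0"
    using zero full by (simp add: centroid_cyc_everywhere[where n = n])
  then have "a ! r \<noteq> cyc (b ! r) \<and> cyc (b ! r) \<noteq> cyc (cyc (c ! r)) \<and> a ! r \<noteq> cyc (cyc (c ! r))"
    if "r < n" for r
    using distinct_letters_if_centroid_sum_zero[OF \<open>d \<noteq> 0\<close>, of a n "cyc_on UNIV b"
        "cyc_on UNIV (cyc_on UNIV c)" r] full that len by (simp add: nth_cyc_on)
  then have letters: "(b ! r = a ! r \<and> c ! r = a ! r) \<or> (b ! r = cyc (a ! r) \<and> c ! r = cyc (cyc (a ! r)))"
    if "r < n" for r
    using that full by (intro distinct_twisted_letters full_word_nth[of _ n])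
  define S where "S = {r. r < n \<and> a ! r \<noteq> b ! r}"
  have "b = cyc_on S a"
  proof (rule nth_equalityI)
    fix r assume "r < length b"
    then have "r < n" using len by simp
    then show "b ! r = cyc_on S a ! r"
      using len letters[of r] by (auto simp: nth_cyc_on S_def)
  qed (use len in simp)
  moreover have "c = cyc_on S (cyc_on S a)"
  proof (rule nth_equalityI)
    fix r assume "r < length c"
    then have r: "r < n" using len by simp
    have in_S: "r \<in> S \<longleftrightarrow> a ! r \<noteq> b ! r"
      using r by (simp add: S_def)
    have "cyc (a ! r) \<noteq> a ! r"
      using r cyc_neq full_word_nth[OF full(1)] by blast
    then show "c ! r = cyc_on S (cyc_on S a) ! r"
      using letters[OF r] by (elim disjE) (simp_all add: nth_cyc_on in_S r len)
  qed (use len in simp)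
  moreover have "S \<noteq> {}"
    using \<open>a \<noteq> b\<close> len nth_equalityI[of a b] by (auto simp: S_def)
  moreover have "S \<subseteq> {..<n}"
    by (auto simp: S_def)
  ultimately show ?thesis
    by (auto simp: local_cycle_def)
qed

lemma full_equilateral_triples_eq:
  assumes "d \<noteq> 0"
  shows "full_equilateral_triples d n =
    (\<Union>S \<in> Pow {..<n} - {{}}. (\<lambda>b. local_cycle b S) ` Full_words n)"
proof (intro equalityI subsetI)
  fix T assume "T \<in> full_equilateral_triples d n"
  then obtain a b c where T: "T = {a, b, c}" "a \<noteq> b" "a \<noteq> c"
      "nondegenerate_equilateral (centroid d a) (centroid d b) (centroid d c)"
    and full: "a \<in> Full_words n" "b \<in> Full_words n" "c \<in> Full_words n"
    unfolding full_equilateral_triples_def equilateral_triples_def by blast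
  have "\<exists>S. S \<noteq> {} \<and> S \<subseteq> {..<n} \<and> T = local_cycle a S"
    using equilateral_imp_rotation_sum[OF T(4)]
  proof
    assume "centroid d a + rot (centroid d b) + rot (rot (centroid d c)) = 0"
    then show ?thesis
      using rotation_sum_imp_local_cycle[OF assms full T(2)] T(1) by simp
  next
    assume "centroid d a + rot (centroid d c) + rot (rot (centroid d b)) = 0"
    then show ?thesis
      using rotation_sum_imp_local_cycle[OF assms full(1,3,2) T(3)] T(1)
      by (simp add: insert_commute)
  qed
  then show "T \<in> (\<Union>S \<in> Pow {..<n} - {{}}. (\<lambda>b. local_cycle b S) ` Full_words n)"
    using full by blast
next
  fix T assume "T \<in> (\<Union>S \<in> Pow {..<n} - {{}}. (\<lambda>b. local_cycle b S) ` Full_words n)"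
  then obtain S b where S: "S \<noteq> {}" "S \<subseteq> {..<n}" and b: "b \<in> Full_words n"
    and T: "T = {b, cyc_on S b, cyc_on S (cyc_on S b)}"
    by (auto simp: local_cycle_def)
  have "w \<in> Delta n" if "w \<in> Full_words n" for w
    using that by (simp add: Full_words_def Delta_def)
  then have "b \<in> Delta n" "cyc_on S b \<in> Delta n" "cyc_on S (cyc_on S b) \<in> Delta n"
    using b by simp_all
  then have "T \<in> equilateral_triples d n"
    unfolding equilateral_triples_def T mem_Collect_eq
    using cyc_on_distinct[OF b S] local_cycle_equilateral[OF assms b S]
    by (intro exI[of _ b] exI[of _ "cyc_on S b"] exI[of _ "cyc_on S (cyc_on S b)"]) simp
  then show "T \<in> full_equilateral_triples d n"
    using T b by (simp add: full_equilateral_triples_def)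
qed

section \<open>Counting local cycles\<close>

lemma Full_words_eq: "Full_words n = {b. set b \<subseteq> {Li, Lj, Lk} \<and> length b = n}"
  by (auto simp: Full_words_def)

lemma finite_Full_words: "finite (Full_words n)"
  unfolding Full_words_eq by (rule finite_lists_length_eq) simp

lemma card_Full_words: "card (Full_words n) = 3 ^ n"
  unfolding Full_words_eq by (subst card_lists_length_eq) (simp_all add: eval_nat_numeral)

lemma card_local_cycle:
  assumes "b \<in> Full_words n" "S \<noteq> {}" "S \<subseteq> {..<n}"
  shows "card (local_cycle b S) = 3"
  using cyc_on_distinct[OF assms] by (simp add: local_cycle_def)

lemma local_cycle_eq_if_mem:
  assumes "c \<in> local_cycle b S"
  shows "local_cycle c S = local_cycle b S"
  using assms by (auto simp: local_cycle_def)

text \<open>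
  Since \<open>cyc_on S\<close> has order three, the cycles with a given \<open>S\<close> are its orbits, each with three
  elements.
\<close>

lemma card_local_cycles_fixed_support:
  assumes "S \<noteq> {}" "S \<subseteq> {..<n}"
  shows "card ((\<lambda>b. local_cycle b S) ` Full_words n) = 3 ^ (n - 1)"
proof -
  let ?C = "(\<lambda>b. local_cycle b S) ` Full_words n"
  have union: "\<Union> ?C = Full_words n"
    by (auto simp: local_cycle_def)
  have "3 * card ?C = card (\<Union> ?C)"
  proof (rule card_partition)
    show "finite ?C" "finite (\<Union> ?C)"
      by (simp_all only: union finite_Full_words finite_imageI)
    show "card c = 3" if "c \<in> ?C" for c
      using that card_local_cycle assms by blast
    show "c1 \<inter> c2 = {}" if "c1 \<in> ?C" "c2 \<in> ?C" "c1 \<noteq> c2" for c1 c2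
      using that local_cycle_eq_if_mem by blast
  qed
  then have "3 * card ?C = 3 ^ n"
    by (simp only: union card_Full_words)
  moreover have "n = Suc (n - 1)"
    using assms by (cases n) auto
  then have "(3::nat) ^ n = 3 * 3 ^ (n - 1)"
    by (metis power_Suc)
  ultimately show ?thesis by simp
qed

text \<open>A triple thus determines \<open>S\<close>, so that cycles with different \<open>S\<close> are counted separately.\<close>

lemma nonconstant_coordinates_local_cycle:
  assumes "b \<in> Full_words n" "S \<subseteq> {..<n}"
  shows "{r. r < n \<and> (\<exists>x \<in> local_cycle b S. \<exists>y \<in> local_cycle b S. x ! r \<noteq> y ! r)} = S"
proof -
  have len: "length b = n"
    using assms by (simp add: Full_words_def)
  have "r \<in> S \<longleftrightarrow> (\<exists>x \<in> local_cycle b S. \<exists>y \<in> local_cycle b S. x ! r \<noteq> y ! r)" if "r < n" for r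
  proof (cases "r \<in> S")
    case True
    then have "cyc_on S b ! r \<noteq> b ! r"
      using that len cyc_neq full_word_nth[OF assms(1) that] by (simp add: nth_cyc_on)
    then show ?thesis
      using True by (auto simp: local_cycle_def)
  next
    case False
    then show ?thesis
      using that len by (auto simp: local_cycle_def nth_cyc_on)
  qed
  then show ?thesis
    using assms(2) by blast
qed

lemma card_local_cycles:
  "card (\<Union>S \<in> Pow {..<n} - {{}}. (\<lambda>b. local_cycle b S) ` Full_words n) = (2 ^ n - 1) * 3 ^ (n - 1)"
proof -
  let ?C = "\<lambda>S. (\<lambda>b. local_cycle b S) ` Full_words n"
  have "?C S \<inter> ?C S' = {}" if SS': "S \<subseteq> {..<n}" "S' \<subseteq> {..<n}" "S \<noteq> S'" for S S'
  proof (rule ccontr)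
    assume "?C S \<inter> ?C S' \<noteq> {}"
    then obtain b b' where b: "b \<in> Full_words n" "b' \<in> Full_words n"
      and eq: "local_cycle b S = local_cycle b' S'" by blast
    have "S = S'"
      using nonconstant_coordinates_local_cycle[OF b(1) SS'(1)]
        nonconstant_coordinates_local_cycle[OF b(2) SS'(2)] unfolding eq by (rule subst)
    then show False
      using SS'(3) by contradiction
  qed
  then have "card (\<Union>S \<in> Pow {..<n} - {{}}. ?C S) = (\<Sum>S \<in> Pow {..<n} - {{}}. card (?C S))"
    by (intro card_UN_disjoint) (auto simp: finite_Full_words)
  also have "\<dots> = (\<Sum>S \<in> Pow {..<n} - {{}}. 3 ^ (n - 1))"
    by (intro sum.cong refl card_local_cycles_fixed_support) auto
  also have "\<dots> = (2 ^ n - 1) * 3 ^ (n - 1)"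
    by (simp add: card_Diff_subset card_Pow)
  finally show ?thesis .
qed

theorem theorem8p5:
  fixes d1 :: real and n :: nat
  assumes "d1 > 0" and "n \<ge> 1"
  shows "(\<forall>T \<in> full_equilateral_triples d1 n. T \<in> local_class n) \<and>
         full_equilateral_triples d1 n = full_local_class d1 n \<and>
         card (full_equilateral_triples d1 n) = (2 ^ n - 1) * 3 ^ (n - 1)"
proof -
  have eq: "full_equilateral_triples d1 n =
      (\<Union>S \<in> Pow {..<n} - {{}}. (\<lambda>b. local_cycle b S) ` Full_words n)"
    using full_equilateral_triples_eq \<open>d1 > 0\<close> by simp
  have "T \<in> local_class n" if "T \<in> full_equilateral_triples d1 n" for T
  proof -
    obtain S b where "S \<noteq> {}" "S \<subseteq> {..<n}" "b \<in> Full_words n" "T = local_cycle b S"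
      using \<open>T \<in> full_equilateral_triples d1 n\<close> unfolding eq by blast
    moreover from this have "b \<in> Delta n" "supp b = {..<n}"
      by (simp_all add: Full_words_def Delta_def supp_full_word)
    ultimately show ?thesis
      unfolding local_class_def by blast
  qed
  moreover from this have "full_equilateral_triples d1 n = full_local_class d1 n"
    unfolding full_local_class_def by blast
  moreover have "card (full_equilateral_triples d1 n) = (2 ^ n - 1) * 3 ^ (n - 1)"
    unfolding eq by (rule card_local_cycles)
  ultimately show ?thesis
    by blast
qed

end
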